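(* Let $\Omega \subset \mathbb{R}^2$ be a bounded open region, let $M,N$ be nonnegative integers, let $a_{m,n}(x,y) \in C^{m+n}(\Omega)$ for $0\le m\le M$ and $0\le n\le N$, and let $r(x,y)$ be a given function on $\Omega$. For $0\le m\le M$ and $0\le n\le N$ define $$b_{m,n}(x,y)=\sum_{p=m}^M \sum_{q=n}^N (-1)^{(p-m)+(q-n)}\binom{p}{m}\binom{q}{n}\frac{\partial^{(p-m)+(q-n)}a_{p,q}(x,y)}{\partial x^{p-m} \partial y^{q-n}}.$$ Then the linear partial differential equation $$\sum_{m=0}^M \sum_{n=0}^N a_{m,n}(x,y)\frac{\partial^{m+n}u(x,y)}{\partial x^m \partial y^n}=r(x,y), \quad (x,y) \in \Omega,$$ can be rewritten in the form $$\sum_{m=0}^M \sum_{n=0}^N \frac{\partial^{m+n}\left(b_{m,n}(x,y)u(x,y)\right)}{\partial x^m \partial y^n}=r(x,y), \quad (x,y) \in \Omega;$$ that is, for every $u \in C^{M+N}(\Omega)$ the left-hand sides of the two equations coincide on $\Omega$.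
   Context: Functions are real-valued, and $C^{k}(\Omega)$ denotes the $k$ times continuously differentiable functions on $\Omega$. Derivatives of order zero in a variable are defined by $$\frac{\partial^{m+0}g(x,y)}{\partial x^m \partial y^0}:=\frac{\partial^m g(x,y)}{\partial x^m},\quad \frac{\partial^{0+n}g(x,y)}{\partial x^0 \partial y^n}:=\frac{\partial^n g(x,y)}{\partial y^n},\quad \frac{\partial^{0+0}g(x,y)}{\partial x^0 \partial y^0}:= g(x,y).$$ *)

theory Defs
  imports "HOL-Analysis.Analysis"
begin

text \<open>
  Functions on a plane set are represented by total functions on \<^typ>\<open>real \<times> real\<close>.  For open \<open>\<Omega>\<close>
  the derivatives below, at points of \<open>\<Omega>\<close>, depend only on the values on \<open>\<Omega>\<close>.
\<close>

definition partial_x :: "(real \<times> real \<Rightarrow> real) \<Rightarrow> real \<times> real \<Rightarrow> real" where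
  "partial_x f = (\<lambda>(x, y). deriv (\<lambda>t. f (t, y)) x)"

definition partial_y :: "(real \<times> real \<Rightarrow> real) \<Rightarrow> real \<times> real \<Rightarrow> real" where
  "partial_y f = (\<lambda>(x, y). deriv (\<lambda>t. f (x, t)) y)"

text \<open>The \<open>y\<close>-derivatives are taken first, as in
  \<open>\<partial>\<^sup>m\<^sup>+\<^sup>n g / \<partial>x\<^sup>m \<partial>y\<^sup>n = \<partial>\<^sup>m/\<partial>x\<^sup>m (\<partial>\<^sup>n g / \<partial>y\<^sup>n)\<close>.\<close>

definition mixed_partial :: "nat \<Rightarrow> nat \<Rightarrow> (real \<times> real \<Rightarrow> real) \<Rightarrow> real \<times> real \<Rightarrow> real" where
  "mixed_partial m n g = (partial_x ^^ m) ((partial_y ^^ n) g)"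

text \<open>\<open>Ck_on k \<Omega> f\<close> says that \<open>f\<close> belongs to \<open>C\<^sup>k(\<Omega>)\<close> for open \<open>\<Omega>\<close>: all partial derivatives of
  \<open>f\<close> of order at most \<open>k\<close>, in every order of differentiation, exist and are continuous on \<open>\<Omega>\<close>.
  The existence clauses are needed because \<^const>\<open>deriv\<close> is total.\<close>

primrec Ck_on :: "nat \<Rightarrow> (real \<times> real) set \<Rightarrow> (real \<times> real \<Rightarrow> real) \<Rightarrow> bool" where
  "Ck_on 0 \<Omega> f \<longleftrightarrow> continuous_on \<Omega> f"
| "Ck_on (Suc k) \<Omega> f \<longleftrightarrow>
     continuous_on \<Omega> f \<and>
     (\<forall>(x, y)\<in>\<Omega>. (\<lambda>t. f (t, y)) differentiable (at x) \<and> (\<lambda>t. f (x, t)) differentiable (at y)) \<and>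
     Ck_on k \<Omega> (partial_x f) \<and> Ck_on k \<Omega> (partial_y f)"

end

theory Submission
  imports Defs
begin

text \<open>
  Write \<open>D\<close> for one of the two partial derivatives.  In one direction, the identity behind the
  theorem is
  \<open>a D\<^sup>p u = (\<Sum>m\<le>p. (-1)\<^sup>p\<^sup>-\<^sup>m (p choose m) D\<^sup>m (D\<^sup>p\<^sup>-\<^sup>m a \<cdot> u))\<close>,
  obtained by moving all derivatives off \<open>u\<close>.  Call the right-hand side \<open>S\<^sub>p(a)\<close>.  Pascal's rule
  gives \<open>S\<^sub>p\<^sub>+\<^sub>1(a) = D(S\<^sub>p(a)) - S\<^sub>p(D a)\<close>, and by induction this is
  \<open>D(a D\<^sup>p u) - D a \<cdot> D\<^sup>p u = a D\<^sup>p\<^sup>+\<^sup>1 u\<close>; beyond linearity, only the product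
  rule for first derivatives is used (\<open>coeff_times_iterated_partial\<close>).

  For mixed derivatives one applies this identity first in \<open>y\<close> and then in \<open>x\<close>
  (\<open>coeff_times_mixed_partial\<close>).  The \<open>y\<close>-step has to see \<open>\<partial>\<^sub>x\<^sup>i \<partial>\<^sub>y\<^sup>j a\<close> as a
  \<open>y\<close>-derivative of \<open>\<partial>\<^sub>x\<^sup>i a\<close>, and this needs the symmetry of second derivatives
  (\<open>partial_x_partial_y_commute\<close>).  Applying the identity to each coefficient \<open>a\<^sub>p\<^sub>,\<^sub>q\<close> and
  exchanging the sums over \<open>(p, q)\<close> and \<open>(m, n)\<close> collects, for each \<open>(m, n)\<close>, exactly the
  terms of \<open>b\<^sub>m\<^sub>,\<^sub>n\<close>.

  The regularity hypotheses fit this argument: \<open>\<partial>\<^sub>x\<^sup>p\<^sup>-\<^sup>m \<partial>\<^sub>y\<^sup>q\<^sup>-\<^sup>n a\<^sub>p\<^sub>,\<^sub>q\<close> is of class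
  \<open>C\<^sup>m\<^sup>+\<^sup>n\<close>, so that each product may be differentiated \<open>m + n\<close> times.
\<close>

section \<open>Partial derivatives on open sets\<close>

lemma eventually_slices_in_open:
  assumes "open \<Omega>" "(x, y) \<in> \<Omega>"
  shows "\<forall>\<^sub>F t in nhds x. (t, y) \<in> \<Omega>" "\<forall>\<^sub>F t in nhds y. (x, t) \<in> \<Omega>"
proof -
  have "open ((\<lambda>t. (t, y)) -` \<Omega>)" "open (Pair x -` \<Omega>)"
    using assms(1) by (auto intro!: open_vimage continuous_intros)
  then show "\<forall>\<^sub>F t in nhds x. (t, y) \<in> \<Omega>" "\<forall>\<^sub>F t in nhds y. (x, t) \<in> \<Omega>"
    using assms(2) by (auto simp: eventually_nhds)
qed

text \<open>
  The identities below hold only on \<open>\<Omega>\<close>, while derivatives are taken of functions on the whole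
  plane; since differentiation is local, an identity on an open set may still be differentiated.
\<close>

lemma partial_cong_on_open:
  assumes D: "D \<in> {partial_x, partial_y}"
    and "open \<Omega>" "\<And>w. w \<in> \<Omega> \<Longrightarrow> f w = g w" "z \<in> \<Omega>"
  shows "D f z = D g z"
proof -
  obtain x y where z: "z = (x, y)" by (cases z)
  note ev = eventually_slices_in_open[OF assms(2), of x y, folded z, OF assms(4)]
  have "deriv (\<lambda>t. f (t, y)) x = deriv (\<lambda>t. g (t, y)) x"
    by (rule deriv_cong_ev[OF eventually_mono[OF ev(1)]]) (auto intro: assms(3))
  moreover have "deriv (\<lambda>t. f (x, t)) y = deriv (\<lambda>t. g (x, t)) y"
    by (rule deriv_cong_ev[OF eventually_mono[OF ev(2)]]) (auto intro: assms(3))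
  ultimately show ?thesis
    using D by (auto simp: z partial_x_def partial_y_def)
qed

lemma iterated_partial_cong_on_open:
  assumes "D \<in> {partial_x, partial_y}" "open \<Omega>" "\<And>w. w \<in> \<Omega> \<Longrightarrow> f w = g w" "z \<in> \<Omega>"
  shows "(D ^^ n) f z = (D ^^ n) g z"
  using assms(4)
proof (induction n arbitrary: z)
  case (Suc n)
  show ?case
    using partial_cong_on_open[OF assms(1,2) Suc.IH Suc.prems] by simp
qed (simp add: assms(3))

lemma mixed_partial_cong_on_open:
  assumes "open \<Omega>" "\<And>w. w \<in> \<Omega> \<Longrightarrow> f w = g w" "z \<in> \<Omega>"
  shows "mixed_partial m n f z = mixed_partial m n g z"
  unfolding mixed_partial_def
  by (intro iterated_partial_cong_on_open[OF _ assms(1)] assms) auto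

lemma Ck_on_cong_on_open:
  assumes "open \<Omega>" "\<And>w. w \<in> \<Omega> \<Longrightarrow> f w = g w" "Ck_on k \<Omega> f"
  shows "Ck_on k \<Omega> g"
  using assms(2,3)
proof (induction k arbitrary: f g)
  case 0
  then show ?case by (simp cong: continuous_on_cong)
next
  case (Suc k)
  have "Ck_on k \<Omega> (D g)" if D: "D \<in> {partial_x, partial_y}" for D
    using Suc.IH[of "D f" "D g"] partial_cong_on_open[OF D assms(1) Suc.prems(1)] Suc.prems(2) D
    by auto
  moreover have "(\<lambda>t. g (t, y)) differentiable (at x)" "(\<lambda>t. g (x, t)) differentiable (at y)"
    if xy: "(x, y) \<in> \<Omega>" for x y
  proof -
    note ev = eventually_slices_in_open[OF assms(1) xy]
    have "(\<lambda>t. f (t, y)) differentiable (at x)" "(\<lambda>t. f (x, t)) differentiable (at y)"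
      using Suc.prems(2) xy by auto
    moreover have "\<forall>\<^sub>F t in nhds x. f (t, y) = g (t, y)"
      by (rule eventually_mono[OF ev(1)]) (rule Suc.prems(1))
    moreover have "\<forall>\<^sub>F t in nhds y. f (x, t) = g (x, t)"
      by (rule eventually_mono[OF ev(2)]) (rule Suc.prems(1))
    ultimately show "(\<lambda>t. g (t, y)) differentiable (at x)" "(\<lambda>t. g (x, t)) differentiable (at y)"
      unfolding real_differentiable_def by (simp_all add: DERIV_cong_ev[OF refl _ refl])
  qed
  moreover have "continuous_on \<Omega> g"
    using Suc.prems by (simp cong: continuous_on_cong)
  ultimately show ?case by auto
qed

section \<open>Rules for functions of class \<open>C\<^sup>k\<close>\<close>

lemma Ck_on_Suc_imp_Ck_on: "Ck_on (Suc k) \<Omega> f \<Longrightarrow> Ck_on k \<Omega> f"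
proof (induction k arbitrary: f)
  case (Suc k)
  then have "Ck_on k \<Omega> (partial_x f)" "Ck_on k \<Omega> (partial_y f)"
    by (simp_all only: Ck_on.simps(2)[of "Suc k"])
  then show ?case
    using Suc.prems unfolding Ck_on.simps(2)[of "Suc k"] Ck_on.simps(2)[of k \<Omega> f] by blast
qed simp

lemma Ck_on_le: "Ck_on l \<Omega> f \<Longrightarrow> k \<le> l \<Longrightarrow> Ck_on k \<Omega> f"
  by (induction l) (auto simp: le_Suc_eq dest: Ck_on_Suc_imp_Ck_on simp del: Ck_on.simps)

lemma Ck_on_partial:
  "D \<in> {partial_x, partial_y} \<Longrightarrow> Ck_on (Suc k) \<Omega> f \<Longrightarrow> Ck_on k \<Omega> (D f)"
  by auto

lemma Ck_on_iterated_partial: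
  assumes "D \<in> {partial_x, partial_y}" "Ck_on (k + n) \<Omega> f"
  shows "Ck_on k \<Omega> ((D ^^ n) f)"
  using assms(2)
proof (induction n arbitrary: k)
  case (Suc n)
  then have "Ck_on (Suc k) \<Omega> ((D ^^ n) f)"
    by (intro Suc.IH) (simp del: Ck_on.simps)
  then show ?case
    using Ck_on_partial[OF assms(1)] by (simp del: Ck_on.simps)
qed simp

lemma Ck_on_mixed_partial: "Ck_on (k + m + n) \<Omega> f \<Longrightarrow> Ck_on k \<Omega> (mixed_partial m n f)"
  unfolding mixed_partial_def by (intro Ck_on_iterated_partial) auto

lemma Ck_on_has_partials:
  assumes "Ck_on (Suc k) \<Omega> f" "(x, y) \<in> \<Omega>"
  shows "((\<lambda>t. f (t, y)) has_real_derivative partial_x f (x, y)) (at x)"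
    and "((\<lambda>t. f (x, t)) has_real_derivative partial_y f (x, y)) (at y)"
  using assms
  by (auto simp: partial_x_def partial_y_def DERIV_deriv_iff_real_differentiable)

lemma partial_add:
  assumes "D \<in> {partial_x, partial_y}" "Ck_on (Suc k) \<Omega> f" "Ck_on (Suc k) \<Omega> g" "z \<in> \<Omega>"
  shows "D (\<lambda>w. f w + g w) z = D f z + D g z"
proof -
  obtain x y where z: "z = (x, y)" by (cases z)
  note F = Ck_on_has_partials[OF assms(2), of x y] and G = Ck_on_has_partials[OF assms(3), of x y]
  show ?thesis
    using assms(1,4) DERIV_imp_deriv[OF DERIV_add[OF F(1) G(1)]]
      DERIV_imp_deriv[OF DERIV_add[OF F(2) G(2)]]
    by (auto simp: z partial_x_def partial_y_def)
qed

lemma partial_mult: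
  assumes "D \<in> {partial_x, partial_y}" "Ck_on (Suc k) \<Omega> f" "Ck_on (Suc k) \<Omega> g" "z \<in> \<Omega>"
  shows "D (\<lambda>w. f w * g w) z = D f z * g z + f z * D g z"
proof -
  obtain x y where z: "z = (x, y)" by (cases z)
  note F = Ck_on_has_partials[OF assms(2), of x y] and G = Ck_on_has_partials[OF assms(3), of x y]
  show ?thesis
    using assms(1,4) DERIV_imp_deriv[OF DERIV_mult[OF F(1) G(1)]]
      DERIV_imp_deriv[OF DERIV_mult[OF F(2) G(2)]]
    by (auto simp: z partial_x_def partial_y_def)
qed

lemma Ck_on_const: "Ck_on k \<Omega> (\<lambda>w. c)"
  by (induction k arbitrary: c) (auto simp: partial_x_def partial_y_def case_prod_unfold)

lemma Ck_on_add:
  assumes "open \<Omega>" "Ck_on k \<Omega> f" "Ck_on k \<Omega> g"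
  shows "Ck_on k \<Omega> (\<lambda>w. f w + g w)"
  using assms(2,3)
proof (induction k arbitrary: f g)
  case (Suc k)
  have "Ck_on k \<Omega> (D (\<lambda>w. f w + g w))" if D: "D \<in> {partial_x, partial_y}" for D
    by (rule Ck_on_cong_on_open[OF assms(1) _
          Suc.IH[OF Ck_on_partial[OF D Suc.prems(1)] Ck_on_partial[OF D Suc.prems(2)]]])
      (rule partial_add[OF D Suc.prems, symmetric])
  then show ?case
    using Suc.prems by (auto intro!: continuous_intros derivative_intros)
qed (auto intro: continuous_intros)

lemma Ck_on_mult:
  assumes "open \<Omega>" "Ck_on k \<Omega> f" "Ck_on k \<Omega> g"
  shows "Ck_on k \<Omega> (\<lambda>w. f w * g w)"
  using assms(2,3)
proof (induction k arbitrary: f g)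
  case (Suc k)
  have "Ck_on k \<Omega> (D (\<lambda>w. f w * g w))" if D: "D \<in> {partial_x, partial_y}" for D
    by (rule Ck_on_cong_on_open[OF assms(1) _ Ck_on_add[OF assms(1)
          Suc.IH[OF Ck_on_partial[OF D Suc.prems(1)] Ck_on_Suc_imp_Ck_on[OF Suc.prems(2)]]
          Suc.IH[OF Ck_on_Suc_imp_Ck_on[OF Suc.prems(1)] Ck_on_partial[OF D Suc.prems(2)]]]])
      (rule partial_mult[OF D Suc.prems, symmetric])
  then show ?case
    using Suc.prems by (auto intro!: continuous_intros derivative_intros)
qed (auto intro: continuous_intros)

lemma Ck_on_cmult: "open \<Omega> \<Longrightarrow> Ck_on k \<Omega> f \<Longrightarrow> Ck_on k \<Omega> (\<lambda>w. c * f w)"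
  by (intro Ck_on_mult Ck_on_const)

lemma Ck_on_sum:
  assumes "open \<Omega>" "\<And>i. i \<in> I \<Longrightarrow> Ck_on k \<Omega> (f i)"
  shows "Ck_on k \<Omega> (\<lambda>w. \<Sum>i\<in>I. f i w)"
  using assms(2)
  by (induction I rule: infinite_finite_induct)
    (simp_all add: Ck_on_const Ck_on_add[OF assms(1)] del: Ck_on.simps)

lemma partial_linear_combination:
  assumes D: "D \<in> {partial_x, partial_y}" and "open \<Omega>"
    and "\<And>i. i \<in> I \<Longrightarrow> Ck_on (Suc k) \<Omega> (f i)" "z \<in> \<Omega>"
  shows "D (\<lambda>w. \<Sum>i\<in>I. c i * f i w) z = (\<Sum>i\<in>I. c i * D (f i) z)"
proof -
  have D_const: "D (\<lambda>w. s) z = 0" for s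
    using D by (auto simp: partial_x_def partial_y_def case_prod_unfold)
  show ?thesis
    using assms(3)
  proof (induction I rule: infinite_finite_induct)
    case (insert i I)
    have "Ck_on (Suc k) \<Omega> (\<lambda>w. \<Sum>i\<in>I. c i * f i w)"
      using insert.prems by (intro Ck_on_sum Ck_on_cmult assms(2)) auto
    moreover have fi: "Ck_on (Suc k) \<Omega> (f i)"
      using insert.prems by blast
    moreover have "D (\<lambda>w. c i * f i w) z = c i * D (f i) z"
      using partial_mult[OF D Ck_on_const fi assms(4)] D_const by simp
    ultimately show ?case
      using insert partial_add[OF D Ck_on_cmult[OF assms(2) fi]] assms(4)
      by (simp del: Ck_on.simps)
  qed (simp_all add: D_const)
qed

lemma iterated_partial_linear_combination:
  assumes D: "D \<in> {partial_x, partial_y}" and "open \<Omega>"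
    and "\<And>i. i \<in> I \<Longrightarrow> Ck_on n \<Omega> (f i)" "z \<in> \<Omega>"
  shows "(D ^^ n) (\<lambda>w. \<Sum>i\<in>I. c i * f i w) z = (\<Sum>i\<in>I. c i * (D ^^ n) (f i) z)"
  using assms(3,4)
proof (induction n arbitrary: z)
  case (Suc n)
  have "D ((D ^^ n) (\<lambda>w. \<Sum>i\<in>I. c i * f i w)) z = D (\<lambda>w. \<Sum>i\<in>I. c i * (D ^^ n) (f i) w) z"
    using Suc by (intro partial_cong_on_open[OF D assms(2)])
      (auto intro: Ck_on_Suc_imp_Ck_on simp del: Ck_on.simps)
  also have "\<dots> = (\<Sum>i\<in>I. c i * D ((D ^^ n) (f i)) z)"
    using Suc.prems by (intro partial_linear_combination[OF D assms(2), where k = 0]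
        Ck_on_iterated_partial[OF D]) (auto simp del: Ck_on.simps)
  finally show ?case by simp
qed simp

lemma mixed_partial_linear_combination:
  assumes "open \<Omega>" "\<And>i. i \<in> I \<Longrightarrow> Ck_on (m + n) \<Omega> (f i)" "z \<in> \<Omega>"
  shows "mixed_partial m n (\<lambda>w. \<Sum>i\<in>I. c i * f i w) z = (\<Sum>i\<in>I. c i * mixed_partial m n (f i) z)"
proof -
  have "(partial_x ^^ m) ((partial_y ^^ n) (\<lambda>w. \<Sum>i\<in>I. c i * f i w)) z
      = (partial_x ^^ m) (\<lambda>w. \<Sum>i\<in>I. c i * (partial_y ^^ n) (f i) w) z"
    by (intro iterated_partial_cong_on_open[OF _ assms(1) _ assms(3)]
        iterated_partial_linear_combination[OF _ assms(1)] Ck_on_le[OF assms(2)]) auto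
  also have "\<dots> = (\<Sum>i\<in>I. c i * (partial_x ^^ m) ((partial_y ^^ n) (f i)) z)"
    using assms(2) by (intro iterated_partial_linear_combination[OF _ assms(1) _ assms(3)]
        Ck_on_iterated_partial) auto
  finally show ?thesis by (simp add: mixed_partial_def)
qed

section \<open>Symmetry of second derivatives\<close>

text \<open>
  The second difference of \<open>f\<close> over a small square is, by two applications of the mean value
  theorem, \<open>h\<^sup>2\<close> times a value of either mixed derivative in the square, depending on which
  variable is treated first.
\<close>

lemma second_difference_eq_mixed_partials:
  assumes f: "Ck_on (Suc (Suc k)) \<Omega> f" and h: "0 < h"
    and box: "{x..x + h} \<times> {y..y + h} \<subseteq> \<Omega>"
  shows "\<exists>s\<in>{x..x + h}. \<exists>t\<in>{y..y + h}.
           f (x + h, y + h) - f (x + h, y) - f (x, y + h) + f (x, y)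
             = h * (h * partial_y (partial_x f) (s, t))" (is "?P")
    and "\<exists>s\<in>{x..x + h}. \<exists>t\<in>{y..y + h}.
           f (x + h, y + h) - f (x + h, y) - f (x, y + h) + f (x, y)
             = h * (h * partial_x (partial_y f) (s, t))" (is "?Q")
proof -
  have fx: "Ck_on (Suc k) \<Omega> (partial_x f)" and fy: "Ck_on (Suc k) \<Omega> (partial_y f)"
    using f by (auto simp del: Ck_on.simps intro: Ck_on_partial)
  have "\<exists>s>x. s < x + h \<and> (f (x + h, y + h) - f (x + h, y)) - (f (x, y + h) - f (x, y))
      = (x + h - x) * (partial_x f (s, y + h) - partial_x f (s, y))"
    by (rule MVT2) (use h box in \<open>auto intro!: DERIV_diff Ck_on_has_partials(1)[OF f]\<close>)
  then obtain s where s: "x < s" "s < x + h"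
    "(f (x + h, y + h) - f (x + h, y)) - (f (x, y + h) - f (x, y))
      = h * (partial_x f (s, y + h) - partial_x f (s, y))"
    by auto
  have "\<exists>t>y. t < y + h \<and> partial_x f (s, y + h) - partial_x f (s, y)
      = (y + h - y) * partial_y (partial_x f) (s, t)"
    by (rule MVT2) (use h box s in \<open>auto intro!: Ck_on_has_partials(2)[OF fx]\<close>)
  then obtain t where "y < t" "t < y + h"
    "partial_x f (s, y + h) - partial_x f (s, y) = h * partial_y (partial_x f) (s, t)"
    by auto
  with s show ?P
    by (intro bexI[of _ s] bexI[of _ t]) auto
  have "\<exists>t>y. t < y + h \<and> (f (x + h, y + h) - f (x, y + h)) - (f (x + h, y) - f (x, y))
      = (y + h - y) * (partial_y f (x + h, t) - partial_y f (x, t))"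
    by (rule MVT2) (use h box in \<open>auto intro!: DERIV_diff Ck_on_has_partials(2)[OF f]\<close>)
  then obtain t where t: "y < t" "t < y + h"
    "(f (x + h, y + h) - f (x, y + h)) - (f (x + h, y) - f (x, y))
      = h * (partial_y f (x + h, t) - partial_y f (x, t))"
    by auto
  have "\<exists>s>x. s < x + h \<and> partial_y f (x + h, t) - partial_y f (x, t)
      = (x + h - x) * partial_x (partial_y f) (s, t)"
    by (rule MVT2) (use h box t in \<open>auto intro!: Ck_on_has_partials(1)[OF fy]\<close>)
  then obtain s where "x < s" "s < x + h"
    "partial_y f (x + h, t) - partial_y f (x, t) = h * partial_x (partial_y f) (s, t)"
    by auto
  with t show ?Q
    by (intro bexI[of _ s] bexI[of _ t]) auto
qed

text \<open>
  On a shrinking square both mixed derivatives tend to their values at the corner, and by the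
  previous lemma each takes the same value somewhere in the square.
\<close>

lemma partial_x_partial_y_commute:
  assumes "open \<Omega>" and f: "Ck_on (Suc (Suc k)) \<Omega> f" and z: "z \<in> \<Omega>"
  shows "partial_x (partial_y f) z = partial_y (partial_x f) z"
proof -
  obtain x y where xy: "z = (x, y)" by (cases z)
  define F where "F = partial_x (partial_y f)"
  define G where "G = partial_y (partial_x f)"
  have "Ck_on k \<Omega> F" "Ck_on k \<Omega> G"
    using f by (simp_all add: F_def G_def)
  then have "Ck_on 0 \<Omega> F" "Ck_on 0 \<Omega> G"
    using Ck_on_le by blast+
  then have cont: "isCont F z" "isCont G z"
    using assms(1) z by (simp_all add: continuous_on_eq_continuous_at)
  have "\<bar>F z - G z\<bar> \<le> e" if "e > 0" for e
  proof -
    obtain d1 where d1: "d1 > 0" "\<And>w. dist w z < d1 \<Longrightarrow> dist (F w) (F z) < e / 2"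
      using cont(1) \<open>e > 0\<close> unfolding continuous_at_eps_delta by (meson half_gt_zero)
    obtain d2 where d2: "d2 > 0" "\<And>w. dist w z < d2 \<Longrightarrow> dist (G w) (G z) < e / 2"
      using cont(2) \<open>e > 0\<close> unfolding continuous_at_eps_delta by (meson half_gt_zero)
    obtain d3 where d3: "d3 > 0" "\<And>w. dist w z < d3 \<Longrightarrow> w \<in> \<Omega>"
      using assms(1) z unfolding open_dist by blast
    \<comment> \<open>Points of the square have distance at most \<open>2 h\<close> from its corner, which is less than \<open>3 h\<close>.\<close>
    define h where "h = Min {d1, d2, d3} / 3"
    have h: "h > 0" "3 * h \<le> d1" "3 * h \<le> d2" "3 * h \<le> d3"
      using d1(1) d2(1) d3(1) by (auto simp: h_def)
    have near: "dist (s, t) z < 3 * h" if "s \<in> {x..x + h}" "t \<in> {y..y + h}" for s t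
    proof -
      have "dist (s, t) z \<le> \<bar>s - x\<bar> + \<bar>t - y\<bar>"
        using sqrt_sum_squares_le_sum_abs[of "s - x" "t - y"]
        by (simp add: xy dist_Pair_Pair dist_real_def)
      also have "\<dots> < 3 * h"
        using that h(1) by auto
      finally show ?thesis .
    qed
    have box: "{x..x + h} \<times> {y..y + h} \<subseteq> \<Omega>"
      using d3(2) less_le_trans[OF near h(4)] by auto
    obtain s t where G: "s \<in> {x..x + h}" "t \<in> {y..y + h}"
        "f (x + h, y + h) - f (x + h, y) - f (x, y + h) + f (x, y) = h * (h * G (s, t))"
      using second_difference_eq_mixed_partials(1)[OF f h(1) box] by (auto simp: G_def)
    obtain s' t' where F: "s' \<in> {x..x + h}" "t' \<in> {y..y + h}"
        "f (x + h, y + h) - f (x + h, y) - f (x, y + h) + f (x, y) = h * (h * F (s', t'))"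
      using second_difference_eq_mixed_partials(2)[OF f h(1) box] by (auto simp: F_def)
    have "F (s', t') = G (s, t)"
      using F(3) G(3) h(1) by simp
    moreover have "dist (F (s', t')) (F z) < e / 2"
      by (rule d1(2)) (use near[OF F(1,2)] h(2) in linarith)
    moreover have "dist (G (s, t)) (G z) < e / 2"
      by (rule d2(2)) (use near[OF G(1,2)] h(3) in linarith)
    ultimately have "dist (F z) (G z) < e"
      by (metis dist_triangle_half_r)
    then show ?thesis
      by (simp add: dist_real_def)
  qed
  then have "\<bar>F z - G z\<bar> \<le> 0"
    by (rule field_le_epsilon) simp
  then show ?thesis
    by (simp add: F_def G_def)
qed

lemma partial_x_iterated_partial_y_commute:
  assumes "open \<Omega>" "Ck_on (Suc n) \<Omega> f" "z \<in> \<Omega>"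
  shows "partial_x ((partial_y ^^ n) f) z = (partial_y ^^ n) (partial_x f) z"
  using assms(2,3)
proof (induction n arbitrary: z)
  case (Suc n)
  have "Ck_on (Suc (Suc 0)) \<Omega> ((partial_y ^^ n) f)"
    using Suc.prems by (intro Ck_on_iterated_partial) (auto simp del: Ck_on.simps)
  then have "partial_x (partial_y ((partial_y ^^ n) f)) z
      = partial_y (partial_x ((partial_y ^^ n) f)) z"
    by (rule partial_x_partial_y_commute[OF assms(1) _ Suc.prems(2)])
  also have "\<dots> = partial_y ((partial_y ^^ n) (partial_x f)) z"
    by (rule partial_cong_on_open[OF _ assms(1) Suc.IH[OF Ck_on_Suc_imp_Ck_on] Suc.prems(2)])
      (simp_all add: Suc.prems(1) del: Ck_on.simps)
  finally show ?case by simp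
qed simp

lemma mixed_partial_commute:
  assumes "open \<Omega>" "Ck_on (m + n) \<Omega> f" "z \<in> \<Omega>"
  shows "mixed_partial m n f z = (partial_y ^^ n) ((partial_x ^^ m) f) z"
  using assms(2,3)
proof (induction m arbitrary: z)
  case (Suc m)
  have "mixed_partial (Suc m) n f z = partial_x (mixed_partial m n f) z"
    by (simp add: mixed_partial_def)
  also have "\<dots> = partial_x ((partial_y ^^ n) ((partial_x ^^ m) f)) z"
    by (rule partial_cong_on_open[OF _ assms(1) Suc.IH[OF Ck_on_le[OF Suc.prems(1)]] Suc.prems(2)])
      simp_all
  also have "\<dots> = (partial_y ^^ n) (partial_x ((partial_x ^^ m) f)) z"
    using Suc.prems by (intro partial_x_iterated_partial_y_commute[OF assms(1)]
        Ck_on_iterated_partial) (simp_all add: add.commute del: Ck_on.simps)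
  finally show ?case by simp
qed (simp add: mixed_partial_def)

section \<open>Moving derivatives off a factor\<close>

text \<open>
  In each coefficient, Pascal's rule separates \<open>p choose (m - 1)\<close>, which after a shift of the
  index multiplies \<open>g (Suc m)\<close>, from \<open>p choose m\<close>, which changes sign because the exponent
  has grown by one.
\<close>

lemma alternating_binomial_sum_Suc:
  fixes g :: "nat \<Rightarrow> real"
  shows "(\<Sum>m\<le>Suc p. (-1) ^ (Suc p - m) * real (Suc p choose m) * g m)
       = (\<Sum>m\<le>p. (-1) ^ (p - m) * real (p choose m) * (g (Suc m) - g m))"
proof -
  have "(\<Sum>m\<le>Suc p. (-1) ^ (Suc p - m) * real (Suc p choose m) * g m)
      = (\<Sum>m\<le>p. (-1) ^ (p - m) * real (p choose m) * g (Suc m))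
        + ((-1) ^ Suc p * g 0 + (\<Sum>m\<le>p. (-1) ^ (p - m) * real (p choose Suc m) * g (Suc m)))"
    by (subst sum.atMost_Suc_shift) (simp add: algebra_simps sum.distrib)
  also have "(-1) ^ Suc p * g 0 + (\<Sum>m\<le>p. (-1) ^ (p - m) * real (p choose Suc m) * g (Suc m))
      = (\<Sum>m\<le>Suc p. (-1) ^ (Suc p - m) * real (p choose m) * g m)"
    by (subst sum.atMost_Suc_shift) simp
  also have "\<dots> = (\<Sum>m\<le>p. - ((-1) ^ (p - m) * real (p choose m) * g m))"
    by (simp add: Suc_diff_le)
  finally show ?thesis
    by (simp add: sum_negf right_diff_distrib sum_subtractf)
qed

text \<open>
  Pascal's rule turns the sum for \<open>Suc p\<close> into the \<open>D\<close>-derivative of the sum for \<open>p\<close>, minus the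
  sum for \<open>p\<close> with \<open>D a\<close> in place of \<open>a\<close>.  By induction these are \<open>D (a D\<^sup>p u)\<close> and
  \<open>D a \<cdot> D\<^sup>p u\<close>, and the product rule leaves \<open>a D\<^sup>p\<^sup>+\<^sup>1 u\<close>.
\<close>

lemma coeff_times_iterated_partial:
  assumes D: "D \<in> {partial_x, partial_y}" and "open \<Omega>"
    and "Ck_on p \<Omega> a" "Ck_on p \<Omega> u" "z \<in> \<Omega>"
  shows "(\<Sum>m\<le>p. (-1) ^ (p - m) * real (p choose m) * (D ^^ m) (\<lambda>w. (D ^^ (p - m)) a w * u w) z)
       = a z * (D ^^ p) u z"
  using assms(3-5)
proof (induction p arbitrary: a z)
  case (Suc p)
  define c where "c m = (-1) ^ (p - m) * real (p choose m)" for m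
  define T where "T a m = (D ^^ m) (\<lambda>w. (D ^^ (p - m)) a w * u w)" for a m
  have T_smooth: "Ck_on (Suc 0) \<Omega> (T a m)" if "m \<le> p" for m
    unfolding T_def using that Suc.prems
    by (intro Ck_on_iterated_partial[OF D] Ck_on_mult[OF assms(2)])
      (auto intro: Ck_on_le simp del: Ck_on.simps)
  have u: "Ck_on p \<Omega> u" and a: "Ck_on p \<Omega> a" "Ck_on p \<Omega> (D a)"
    using Suc.prems Ck_on_Suc_imp_Ck_on Ck_on_partial[OF D] by blast+
  have "(\<Sum>m\<le>Suc p. (-1) ^ (Suc p - m) * real (Suc p choose m)
           * (D ^^ m) (\<lambda>w. (D ^^ (Suc p - m)) a w * u w) z)
      = (\<Sum>m\<le>p. c m * ((D ^^ Suc m) (\<lambda>w. (D ^^ (Suc p - Suc m)) a w * u w) z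
                       - (D ^^ m) (\<lambda>w. (D ^^ (Suc p - m)) a w * u w) z))"
    unfolding c_def by (rule alternating_binomial_sum_Suc)
  also have "\<dots> = (\<Sum>m\<le>p. c m * (D (T a m) z - T (D a) m z))"
    by (intro sum.cong refl) (simp add: T_def Suc_diff_le funpow_swap1)
  also have "\<dots> = (\<Sum>m\<le>p. c m * D (T a m) z) - (\<Sum>m\<le>p. c m * T (D a) m z)"
    by (simp add: right_diff_distrib sum_subtractf)
  also have "(\<Sum>m\<le>p. c m * D (T a m) z) = D (\<lambda>w. \<Sum>m\<le>p. c m * T a m w) z"
    using T_smooth Suc.prems(3)
    by (intro partial_linear_combination[OF D assms(2), symmetric, where k = 0]) auto
  also have "\<dots> = D (\<lambda>w. a w * (D ^^ p) u w) z"
    using Suc.IH[OF a(1) u] Suc.prems(3)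
    by (intro partial_cong_on_open[OF D assms(2)]) (auto simp: c_def T_def)
  also have "\<dots> = D a z * (D ^^ p) u z + a z * D ((D ^^ p) u) z"
    using Suc.prems by (intro partial_mult[OF D, where k = 0] Ck_on_iterated_partial[OF D])
      (auto intro: Ck_on_le simp del: Ck_on.simps)
  also have "(\<Sum>m\<le>p. c m * T (D a) m z) = D a z * (D ^^ p) u z"
    unfolding c_def T_def by (rule Suc.IH[OF a(2) u Suc.prems(3)])
  finally show ?case by simp
qed simp

text \<open>
  For fixed \<open>m\<close>, the inner sum over \<open>n\<close> is the one-directional identity in \<open>y\<close> for the
  coefficient \<open>\<partial>\<^sub>x\<^sup>p\<^sup>-\<^sup>m a\<close>, once derivatives of \<open>a\<close> are commuted; what remains is the identity
  in \<open>x\<close> for the function \<open>\<partial>\<^sub>y\<^sup>q u\<close>.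
\<close>

lemma coeff_times_mixed_partial:
  assumes "open \<Omega>" "Ck_on (p + q) \<Omega> a" "Ck_on (p + q) \<Omega> u" "z \<in> \<Omega>"
  shows "(\<Sum>m\<le>p. \<Sum>n\<le>q. (-1) ^ ((p - m) + (q - n)) * real (p choose m) * real (q choose n)
            * mixed_partial m n (\<lambda>w. mixed_partial (p - m) (q - n) a w * u w) z)
       = a z * mixed_partial p q u z"
proof -
  define A where "A m = (partial_x ^^ (p - m)) a" for m
  define c where "c n = (-1) ^ (q - n) * real (q choose n)" for n
  define P where "P m n = (\<lambda>w. (partial_y ^^ (q - n)) (A m) w * u w)" for m n
  have A_smooth: "Ck_on (m + q) \<Omega> (A m)" if "m \<le> p" for m
    unfolding A_def using that assms(2) by (intro Ck_on_iterated_partial) (auto simp: add.commute)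
  have P_smooth: "Ck_on (m + n) \<Omega> (P m n)" if "m \<le> p" "n \<le> q" for m n
    unfolding P_def using that A_smooth[OF that(1)] assms(3)
    by (intro Ck_on_mult[OF assms(1)] Ck_on_iterated_partial) (auto intro: Ck_on_le)
  have inner: "(\<Sum>n\<le>q. c n * mixed_partial m n (\<lambda>w. mixed_partial (p - m) (q - n) a w * u w) z)
      = (partial_x ^^ m) (\<lambda>w. A m w * (partial_y ^^ q) u w) z" if m: "m \<le> p" for m
  proof -
    have "(\<Sum>n\<le>q. c n * mixed_partial m n (\<lambda>w. mixed_partial (p - m) (q - n) a w * u w) z)
        = (\<Sum>n\<le>q. c n * (partial_x ^^ m) ((partial_y ^^ n) (P m n)) z)"
    proof (intro sum.cong refl arg_cong2[where f = "(*)"])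
      fix n assume "n \<in> {..q}"
      then have "Ck_on ((p - m) + (q - n)) \<Omega> a"
        using assms(2) by (elim Ck_on_le) auto
      then have "mixed_partial m n (\<lambda>w. mixed_partial (p - m) (q - n) a w * u w) z
          = mixed_partial m n (P m n) z"
        using mixed_partial_commute[OF assms(1)]
        by (intro mixed_partial_cong_on_open[OF assms(1) _ assms(4)]) (simp add: P_def A_def)
      then show "mixed_partial m n (\<lambda>w. mixed_partial (p - m) (q - n) a w * u w) z
          = (partial_x ^^ m) ((partial_y ^^ n) (P m n)) z"
        by (simp add: mixed_partial_def)
    qed
    also have "\<dots> = (partial_x ^^ m) (\<lambda>w. \<Sum>n\<le>q. c n * (partial_y ^^ n) (P m n) w) z"
      using P_smooth[OF m] assms(4)
      by (intro iterated_partial_linear_combination[OF _ assms(1), symmetric]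
          Ck_on_iterated_partial) auto
    also have "\<dots> = (partial_x ^^ m) (\<lambda>w. A m w * (partial_y ^^ q) u w) z"
    proof (rule iterated_partial_cong_on_open[OF _ assms(1) _ assms(4)])
      fix w assume "w \<in> \<Omega>"
      then show "(\<Sum>n\<le>q. c n * (partial_y ^^ n) (P m n) w) = A m w * (partial_y ^^ q) u w"
        unfolding c_def P_def using A_smooth[OF m] assms(3)
        by (intro coeff_times_iterated_partial[OF _ assms(1)]) (auto intro: Ck_on_le)
    qed simp
    finally show ?thesis .
  qed
  have "(\<Sum>m\<le>p. \<Sum>n\<le>q. (-1) ^ ((p - m) + (q - n)) * real (p choose m) * real (q choose n)
            * mixed_partial m n (\<lambda>w. mixed_partial (p - m) (q - n) a w * u w) z)
      = (\<Sum>m\<le>p. (-1) ^ (p - m) * real (p choose m)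
            * (\<Sum>n\<le>q. c n * mixed_partial m n (\<lambda>w. mixed_partial (p - m) (q - n) a w * u w) z))"
    by (simp only: c_def sum_distrib_left power_add mult_ac)
  also have "\<dots> = (\<Sum>m\<le>p. (-1) ^ (p - m) * real (p choose m)
            * (partial_x ^^ m) (\<lambda>w. (partial_x ^^ (p - m)) a w * (partial_y ^^ q) u w) z)"
    using inner by (simp add: A_def)
  also have "\<dots> = a z * (partial_x ^^ p) ((partial_y ^^ q) u) z"
    using assms by (intro coeff_times_iterated_partial Ck_on_iterated_partial)
      (auto intro: Ck_on_le)
  finally show ?thesis by (simp add: mixed_partial_def)
qed

section \<open>Rewriting the differential equation\<close>

lemma sum_upper_triangle_swap:
  fixes f :: "nat \<Rightarrow> nat \<Rightarrow> 'a::comm_monoid_add"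
  shows "(\<Sum>m=0..M. \<Sum>p=m..M. f m p) = (\<Sum>p=0..M. \<Sum>m\<le>p. f m p)"
proof -
  have "(\<Sum>m=0..M. \<Sum>p=m..M. f m p) = (\<Sum>m=0..M. \<Sum>p | p \<in> {0..M} \<and> m \<le> p. f m p)"
    by (intro sum.cong) auto
  also have "\<dots> = (\<Sum>p=0..M. \<Sum>m | m \<in> {0..M} \<and> m \<le> p. f m p)"
    by (intro sum.swap_restrict) auto
  also have "\<dots> = (\<Sum>p=0..M. \<Sum>m\<le>p. f m p)"
    by (intro sum.cong) auto
  finally show ?thesis .
qed

theorem theorem4:
  fixes \<Omega> :: "(real \<times> real) set"
    and M N :: nat
    and a b :: "nat \<Rightarrow> nat \<Rightarrow> real \<times> real \<Rightarrow> real"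
    and r :: "real \<times> real \<Rightarrow> real"
  assumes "open \<Omega>" and "bounded \<Omega>"
    and "\<And>m n. m \<le> M \<Longrightarrow> n \<le> N \<Longrightarrow> Ck_on (m + n) \<Omega> (a m n)"
    and "\<And>m n z. m \<le> M \<Longrightarrow> n \<le> N \<Longrightarrow> z \<in> \<Omega> \<Longrightarrow>
           b m n z = (\<Sum>p=m..M. \<Sum>q=n..N.
             (-1) ^ ((p - m) + (q - n)) * real (p choose m) * real (q choose n)
               * mixed_partial (p - m) (q - n) (a p q) z)"
  shows "\<forall>u. Ck_on (M + N) \<Omega> u \<longrightarrow>
           (\<forall>z\<in>\<Omega>. (\<Sum>m=0..M. \<Sum>n=0..N. a m n z * mixed_partial m n u z)
                 = (\<Sum>m=0..M. \<Sum>n=0..N. mixed_partial m n (\<lambda>w. b m n w * u w) z)) \<and>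
           ((\<forall>z\<in>\<Omega>. (\<Sum>m=0..M. \<Sum>n=0..N. a m n z * mixed_partial m n u z) = r z) \<longleftrightarrow>
            (\<forall>z\<in>\<Omega>. (\<Sum>m=0..M. \<Sum>n=0..N. mixed_partial m n (\<lambda>w. b m n w * u w) z) = r z))"
proof -
  have key: "(\<Sum>m=0..M. \<Sum>n=0..N. a m n z * mixed_partial m n u z)
           = (\<Sum>m=0..M. \<Sum>n=0..N. mixed_partial m n (\<lambda>w. b m n w * u w) z)"
    if u: "Ck_on (M + N) \<Omega> u" and z: "z \<in> \<Omega>" for u z
  proof -
    define c where "c m n p q = (-1) ^ ((p - m) + (q - n)) * real (p choose m) * real (q choose n)"
      for m n p q :: nat
    define P where "P m n p q = (\<lambda>w. mixed_partial (p - m) (q - n) (a p q) w * u w)" for m n p q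
    have P_smooth: "Ck_on (m + n) \<Omega> (P m n p q)"
      if "p \<in> {m..M}" "q \<in> {n..N}" for m n p q
    proof -
      \<comment> \<open>The coefficient \<open>a p q\<close> has exactly the derivatives needed.\<close>
      have "(m + n) + (p - m) + (q - n) = p + q"
        using that by auto
      then have "Ck_on (m + n) \<Omega> (mixed_partial (p - m) (q - n) (a p q))"
        using that assms(3)[of p q] by (intro Ck_on_mixed_partial) auto
      then show ?thesis
        unfolding P_def using that u by (intro Ck_on_mult[OF assms(1)]) (auto intro: Ck_on_le)
    qed
    have expand: "mixed_partial m n (\<lambda>w. b m n w * u w) z
        = (\<Sum>p=m..M. \<Sum>q=n..N. c m n p q * mixed_partial m n (P m n p q) z)"
      if "m \<le> M" "n \<le> N" for m n
    proof -
      have "b m n w = (\<Sum>p=m..M. \<Sum>q=n..N. c m n p q * mixed_partial (p - m) (q - n) (a p q) w)"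
        if "w \<in> \<Omega>" for w
        unfolding c_def by (rule assms(4)[OF \<open>m \<le> M\<close> \<open>n \<le> N\<close> that])
      then have "mixed_partial m n (\<lambda>w. b m n w * u w) z
          = mixed_partial m n (\<lambda>w. \<Sum>i\<in>{m..M} \<times> {n..N}.
              c m n (fst i) (snd i) * P m n (fst i) (snd i) w) z"
        by (intro mixed_partial_cong_on_open[OF assms(1) _ z])
          (simp add: P_def sum_distrib_right sum.cartesian_product case_prod_unfold mult.assoc)
      also have "\<dots> = (\<Sum>i\<in>{m..M} \<times> {n..N}.
              c m n (fst i) (snd i) * mixed_partial m n (P m n (fst i) (snd i)) z)"
        using P_smooth z by (intro mixed_partial_linear_combination[OF assms(1)]) auto
      finally show ?thesis
        by (simp add: sum.cartesian_product case_prod_unfold)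
    qed
    have "(\<Sum>m=0..M. \<Sum>n=0..N. mixed_partial m n (\<lambda>w. b m n w * u w) z)
        = (\<Sum>m=0..M. \<Sum>n=0..N. \<Sum>p=m..M. \<Sum>q=n..N. c m n p q * mixed_partial m n (P m n p q) z)"
      using expand by simp
    also have "\<dots>
        = (\<Sum>m=0..M. \<Sum>p=m..M. \<Sum>n=0..N. \<Sum>q=n..N. c m n p q * mixed_partial m n (P m n p q) z)"
      by (intro sum.cong refl sum.swap)
    also have "\<dots>
        = (\<Sum>p=0..M. \<Sum>m\<le>p. \<Sum>q=0..N. \<Sum>n\<le>q. c m n p q * mixed_partial m n (P m n p q) z)"
      by (simp only: sum_upper_triangle_swap)
    also have "\<dots>
        = (\<Sum>p=0..M. \<Sum>q=0..N. \<Sum>m\<le>p. \<Sum>n\<le>q. c m n p q * mixed_partial m n (P m n p q) z)"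
      by (intro sum.cong refl sum.swap)
    also have "\<dots> = (\<Sum>p=0..M. \<Sum>q=0..N. a p q z * mixed_partial p q u z)"
      unfolding c_def P_def using assms(3) u z
      by (intro sum.cong refl coeff_times_mixed_partial[OF assms(1)]) (auto intro: Ck_on_le)
    finally show ?thesis by simp
  qed
  show ?thesis
  proof (intro allI impI conjI ballI)
    fix u z assume "Ck_on (M + N) \<Omega> u" "z \<in> \<Omega>"
    then show "(\<Sum>m=0..M. \<Sum>n=0..N. a m n z * mixed_partial m n u z)
        = (\<Sum>m=0..M. \<Sum>n=0..N. mixed_partial m n (\<lambda>w. b m n w * u w) z)"
      by (rule key)
  next
    fix u assume "Ck_on (M + N) \<Omega> u"
    then show "(\<forall>z\<in>\<Omega>. (\<Sum>m=0..M. \<Sum>n=0..N. a m n z * mixed_partial m n u z) = r z) \<longleftrightarrow>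
        (\<forall>z\<in>\<Omega>. (\<Sum>m=0..M. \<Sum>n=0..N. mixed_partial m n (\<lambda>w. b m n w * u w) z) = r z)"
      using key by simp
  qed
qed

end
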